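(* Let $\tau\in\mathbf C$ with $\operatorname{Im}\tau>0$ and $q=e^{\pi i\tau}$. For all $x,y,z\in\mathbf C$ the following four identities hold: $$3\vartheta_1(z+x|\tau)\vartheta_1(z+y|\tau)\vartheta_1(z-x-y|\tau)=A^{\dagger}\left(-x,-y\Big|\tfrac{\tau}{3}\right)\vartheta_1\left(z\Big|\tfrac{\tau}{3}\right)-C^{\dagger}\left(x,y\Big|\tfrac{\tau}{3}\right)\vartheta_1\left(z-\tfrac{\pi}{3}\Big|\tfrac{\tau}{3}\right)-C^{\dagger}\left(-x,-y\Big|\tfrac{\tau}{3}\right)\vartheta_1\left(z+\tfrac{\pi}{3}\Big|\tfrac{\tau}{3}\right),$$ $$3\vartheta_3(z+x|\tau)\vartheta_3(z+y|\tau)\vartheta_3(z-x-y|\tau)=A^{\dagger}\left(-x,-y\Big|\tfrac{\tau}{3}\right)\vartheta_3\left(z\Big|\tfrac{\tau}{3}\right)+C^{\dagger}\left(x,y\Big|\tfrac{\tau}{3}\right)\vartheta_3\left(z-\tfrac{\pi}{3}\Big|\tfrac{\tau}{3}\right)+C^{\dagger}\left(-x,-y\Big|\tfrac{\tau}{3}\right)\vartheta_3\left(z+\tfrac{\pi}{3}\Big|\tfrac{\tau}{3}\right),$$ $$\left(C^\dagger(x,y|\tau)\right)^3-\left(C^\dagger(-x,-y|\tau)\right)^3=q^2e^{4ix+2iy}\left(C^\dagger(x+\pi\tau,y|\tau)\right)^3-q^2e^{4ix+2iy}\left(C^\dagger(-x-\pi\tau,-y|\tau)\right)^3$$ and $$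\left(A^\dagger(x,y|\tau)\right)^3-\left(C^\dagger(x,y|\tau)\right)^3=q^2e^{4ix+2iy}\left(A^\dagger(x+\pi\tau,y|\tau)\right)^3-q^2e^{4ix+2iy}\left(C^\dagger(x+\pi\tau,y|\tau)\right)^3.$$
   Context: For $\operatorname{Im}\tau>0$ put $q=e^{\pi i\tau}$, with real powers $q^r=e^{\pi i r\tau}$, and $\omega=e^{2\pi i/3}$. The Jacobi theta functions used are $$\vartheta_1(z|\tau)=-i\sum_{n=-\infty}^{\infty}(-1)^nq^{(2n+1)^2/4}e^{(2n+1)iz},\qquad \vartheta_3(z|\tau)=\sum_{n=-\infty}^\infty q^{n^2}e^{2niz}.$$ The two-variable series are $$A^{\dagger}(x,y|\tau)=\sum_{m,n\in\mathbf Z}q^{2(m^2-mn+n^2)}e^{2imx}e^{2iny},\qquad C^{\dagger}(x,y|\tau)=\sum_{m,n\in\mathbf Z}\omega^{m+n}q^{2(m^2-mn+n^2)}e^{2imx}e^{2iny}.$$ When the last argument is $\tau/3$ instead of $\tau$, $q$ is replaced throughout the definition by $e^{\pi i\tau/3}$. *)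

theory Defs
  imports "HOL-Analysis.Analysis"
begin

text \<open>
  The real power \<open>q\<^sup>r\<close> of the nome \<open>q = exp (\<pi> \<i> \<tau>)\<close>. It is defined through \<open>\<tau>\<close>, since for
  non-integral \<open>r\<close> it is not determined by \<open>q\<close> alone (the principal branch of \<open>q powr r\<close> would be
  wrong in general).
\<close>
definition nome_power :: "complex \<Rightarrow> real \<Rightarrow> complex" where
  "nome_power \<tau> r = exp (of_real pi * \<i> * of_real r * \<tau>)"

definition omega :: complex where
  "omega = exp (2 * of_real pi * \<i> / 3)"

text \<open>
  The argument order is that of the usual notation \<open>\<theta>(z | \<tau>)\<close>. All four series converge absolutely
  for \<open>Im \<tau> > 0\<close>, so they are rendered as unordered sums over the integers or over pairs of integers.
\<close>
definition theta1 :: "complex \<Rightarrow> complex \<Rightarrow> complex" where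
  "theta1 z \<tau> = - \<i> * (\<Sum>\<^sub>\<infinity>n\<in>(UNIV :: int set).
     (- 1) powi n * nome_power \<tau> (of_int ((2 * n + 1)\<^sup>2) / 4) * exp (of_int (2 * n + 1) * \<i> * z))"

definition theta3 :: "complex \<Rightarrow> complex \<Rightarrow> complex" where
  "theta3 z \<tau> = (\<Sum>\<^sub>\<infinity>n\<in>(UNIV :: int set).
     nome_power \<tau> (of_int (n\<^sup>2)) * exp (2 * of_int n * \<i> * z))"

definition A_dagger :: "complex \<Rightarrow> complex \<Rightarrow> complex \<Rightarrow> complex" where
  "A_dagger x y \<tau> = (\<Sum>\<^sub>\<infinity>(m, n)\<in>(UNIV :: (int \<times> int) set).
     nome_power \<tau> (of_int (2 * (m\<^sup>2 - m * n + n\<^sup>2)))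
       * exp (2 * \<i> * of_int m * x) * exp (2 * \<i> * of_int n * y))"

definition C_dagger :: "complex \<Rightarrow> complex \<Rightarrow> complex \<Rightarrow> complex" where
  "C_dagger x y \<tau> = (\<Sum>\<^sub>\<infinity>(m, n)\<in>(UNIV :: (int \<times> int) set).
     omega powi (m + n) * nome_power \<tau> (of_int (2 * (m\<^sup>2 - m * n + n\<^sup>2)))
       * exp (2 * \<i> * of_int m * x) * exp (2 * \<i> * of_int n * y))"

end

theory Submission
  imports Defs
begin

text \<open>
  All four identities are term-by-term statements about triple sums. Summing the right-hand side of
  the \<open>\<theta>\<^sub>3\<close> identity over the cube roots of unity keeps one third of the terms, and these are
  matched with the terms of the product on the left by a linear substitution; the \<open>\<theta>\<^sub>1\<close> identity is
  its translate by \<open>z \<mapsto> z + \<pi>/2 + \<pi>\<tau>/2\<close>. For the cubic identities, the factor \<open>q\<^sup>2 e\<^sup>4\<^sup>i\<^sup>x\<^sup>+\<^sup>2\<^sup>i\<^sup>y\<close>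
  together with the shift of \<open>x\<close> by \<open>\<pi>\<tau>\<close> replaces the hexagonal lattice \<open>L\<close> by its coset
  \<open>L + (2/3, 1/3)\<close> in the dual lattice. The triples with sum \<open>V\<close> in \<open>L\<close> and in this coset have the
  same norms unless the class of \<open>V\<close> modulo 3 is zero, because a rotation by \<open>\<plusminus>2\<pi>/3\<close> about \<open>V / 3\<close>
  interchanges them. In a difference of two cubes with different characters the class zero cancels.
\<close>

section \<open>Products of absolutely convergent sums and a summable majorant\<close>

lemma summable_on_product_complex:
  fixes f :: "'a \<Rightarrow> complex" and g :: "'b \<Rightarrow> complex"
  assumes f: "f summable_on A" and g: "g summable_on B"
  shows "(\<lambda>(a, b). f a * g b) summable_on A \<times> B"
proof -
  have f': "(\<lambda>a. norm (f a)) summable_on A" and g': "(\<lambda>b. norm (g b)) summable_on B"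
    using f g by (simp_all add: summable_on_iff_abs_summable_on_complex)
  have "(\<lambda>p. norm (case p of (a, b) \<Rightarrow> f a * g b)) summable_on A \<times> B"
    unfolding Infinite_Sum.abs_summable_on_Sigma_iff
    using f' g' infsum_nonneg[of B "\<lambda>b. norm (g b)"]
    by (auto simp: norm_mult infsum_cmult_right' abs_mult intro!: summable_on_cmult_right summable_on_cmult_left)
  then show ?thesis
    by (rule abs_summable_summable)
qed

lemma infsum_product_complex:
  fixes f :: "'a \<Rightarrow> complex" and g :: "'b \<Rightarrow> complex"
  assumes "f summable_on A" and "g summable_on B"
  shows "(\<Sum>\<^sub>\<infinity>(a, b)\<in>A \<times> B. f a * g b) = infsum f A * infsum g B"
proof -
  have "(\<Sum>\<^sub>\<infinity>(a, b)\<in>A \<times> B. f a * g b) = (\<Sum>\<^sub>\<infinity>a\<in>A. \<Sum>\<^sub>\<infinity>b\<in>B. f a * g b)"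
    using summable_on_product_complex[OF assms]
    by (subst infsum_Sigma'_banach) auto
  then show ?thesis
    by (simp add: infsum_cmult_left' infsum_cmult_right')
qed

lemma summable_on_exp_neg_abs_int:
  "(\<lambda>n::int. exp (- \<bar>real_of_int n\<bar>)) summable_on UNIV"
proof -
  have "summable (\<lambda>n. exp (- 1 :: real) ^ n)"
    by (rule summable_geometric) simp
  then have nat: "(\<lambda>n::nat. exp (- real n)) summable_on UNIV"
    by (subst summable_on_UNIV_nonneg_real_iff)
      (auto simp flip: exp_of_nat_mult)
  have "(\<lambda>n::int. exp (- \<bar>real_of_int n\<bar>)) summable_on range int"
    by (subst summable_on_reindex) (auto simp: o_def nat)
  moreover have "(\<lambda>n::int. exp (- \<bar>real_of_int n\<bar>)) summable_on range (\<lambda>n. - int n)"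
    by (subst summable_on_reindex) (auto simp: o_def nat inj_on_def)
  moreover have "UNIV = range int \<union> range (\<lambda>n. - int n)"
    by (auto, metis int_cases2 rangeI)
  ultimately show ?thesis
    by (metis summable_on_union)
qed

section \<open>Exponential form and convergence of the theta and lattice series\<close>

text \<open>Terms are kept as a single exponential, so that identities between them reduce to
  algebra in the exponents.\<close>

definition theta_term :: "complex \<Rightarrow> complex \<Rightarrow> int \<Rightarrow> complex" where
  "theta_term z \<tau> n = exp (\<i> * (of_real pi * of_int (n\<^sup>2) * \<tau> + 2 * of_int n * z))"

definition lattice_term :: "complex \<Rightarrow> complex \<Rightarrow> complex \<Rightarrow> int \<times> int \<Rightarrow> complex" where
  "lattice_term x y \<tau> = (\<lambda>(m, n). exp (\<i> * (2 * of_real pi * of_int (m\<^sup>2 - m * n + n\<^sup>2) * \<tau>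
     + 2 * (of_int m * x + of_int n * y))))"

text \<open>The weight \<open>w\<close> unites both series: \<open>1\<close> gives
  \<open>A_dagger\<close>, \<open>omega\<close> gives \<open>C_dagger\<close>, and
  \<open>inverse omega\<close> gives \<open>C_dagger\<close> with both arguments negated.\<close>

definition dagger :: "complex \<Rightarrow> complex \<Rightarrow> complex \<Rightarrow> complex \<Rightarrow> complex" where
  "dagger w x y \<tau> = (\<Sum>\<^sub>\<infinity>(m, n)\<in>UNIV. w powi (m + n) * lattice_term x y \<tau> (m, n))"

lemma theta3_eq: "theta3 z \<tau> = (\<Sum>\<^sub>\<infinity>n\<in>UNIV. theta_term z \<tau> n)"
  unfolding theta3_def nome_power_def theta_term_def
  by (intro infsum_cong) (simp flip: exp_add add: algebra_simps)

lemma A_dagger_eq: "A_dagger x y \<tau> = dagger 1 x y \<tau>"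
  unfolding A_dagger_def dagger_def nome_power_def lattice_term_def
  by (intro infsum_cong) (auto simp flip: exp_add simp: algebra_simps)

lemma C_dagger_eq: "C_dagger x y \<tau> = dagger omega x y \<tau>"
  unfolding C_dagger_def dagger_def nome_power_def lattice_term_def
  by (intro infsum_cong) (auto simp flip: exp_add simp: algebra_simps)

text \<open>Negating \<open>(m, n)\<close> preserves the quadratic form and inverts the
  character.\<close>

lemma dagger_minus: "dagger w (- x) (- y) \<tau> = dagger (inverse w) x y \<tau>"
  unfolding dagger_def
  by (rule infsum_reindex_bij_witness[of _ uminus uminus])
    (auto simp: lattice_term_def algebra_simps power_int_minus power_int_inverse
      simp flip: power_int_minus)

lemma theta_term_summable:
  assumes "Im \<tau> > 0"
  shows "theta_term z \<tau> summable_on UNIV"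
proof -
  define a where "a = pi * Im \<tau>"
  \<comment> \<open>The added 1 leaves the majorant \<open>exp (- u)\<close> once the square in
    \<open>u\<close> is completed; the rest is a constant.\<close>
  define b where "b = 2 * \<bar>Im z\<bar> + 1"
  have a: "a > 0"
    using assms by (simp add: a_def)
  have bound: "norm (theta_term z \<tau> n) \<le> exp (b\<^sup>2 / (4 * a)) * exp (- \<bar>real_of_int n\<bar>)" for n
  proof -
    define u where "u = \<bar>real_of_int n\<bar>"
    have "norm (theta_term z \<tau> n) = exp (- (a * u\<^sup>2) - 2 * of_int n * Im z)"
      by (simp add: theta_term_def norm_exp_eq_Re a_def u_def algebra_simps flip: of_int_power)
    also have "- (a * u\<^sup>2) - 2 * of_int n * Im z \<le> - (a * u\<^sup>2) + 2 * u * \<bar>Im z\<bar>"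
      using abs_ge_minus_self[of "of_int n * Im z"] by (simp add: u_def abs_mult mult_ac)
    also have "\<dots> \<le> b\<^sup>2 / (4 * a) - u"
    proof -
      have "0 \<le> (2 * a * u - b)\<^sup>2 / (4 * a)"
        using a by simp
      also have "\<dots> = a * u\<^sup>2 - b * u + b\<^sup>2 / (4 * a)"
        using a by (simp add: field_simps power2_eq_square)
      finally show ?thesis
        by (simp add: b_def algebra_simps)
    qed
    finally show ?thesis
      by (simp add: u_def flip: exp_add)
  qed
  have "(\<lambda>n. norm (theta_term z \<tau> n)) summable_on UNIV"
    by (rule Infinite_Sum.abs_summable_on_comparison_test'[OF summable_on_cmult_right bound])
      (rule summable_on_exp_neg_abs_int)
  then show ?thesis
    by (rule abs_summable_summable)
qed

text \<open>Since 2 (m^2 - m n + n^2) = m^2 + n^2 + (m - n)^2, a product of two theta terms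
  dominates.\<close>

lemma weighted_lattice_term_summable:
  assumes "Im \<tau> > 0" and w: "norm w = 1"
  shows "(\<lambda>(m, n). w powi (m + n) * lattice_term x y \<tau> (m, n)) summable_on UNIV"
proof -
  have "(\<lambda>(m, n). theta_term x \<tau> m * theta_term y \<tau> n) summable_on UNIV"
    using summable_on_product_complex[OF theta_term_summable theta_term_summable] assms by simp
  then have "(\<lambda>p. norm (case p of (m, n) \<Rightarrow> theta_term x \<tau> m * theta_term y \<tau> n)) summable_on UNIV"
    by (simp only: summable_on_iff_abs_summable_on_complex)
  then have "(\<lambda>p. norm (case p of (m, n) \<Rightarrow> w powi (m + n) * lattice_term x y \<tau> (m, n))) summable_on UNIV"
  proof (rule Infinite_Sum.abs_summable_on_comparison_test)
    fix p :: "int \<times> int"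
    obtain m n where p: "p = (m, n)" by force
    have "0 \<le> pi * Im \<tau> * (real_of_int m - real_of_int n)\<^sup>2"
      using assms by simp
    then show "norm (case p of (m, n) \<Rightarrow> w powi (m + n) * lattice_term x y \<tau> (m, n))
        \<le> norm (case p of (m, n) \<Rightarrow> theta_term x \<tau> m * theta_term y \<tau> n)"
      by (simp add: p lattice_term_def theta_term_def norm_mult norm_power_int w norm_exp_eq_Re
          algebra_simps power2_eq_square flip: exp_add)
  qed
  then show ?thesis
    by (rule abs_summable_summable)
qed

section \<open>Triples of lattice vectors: cubes, residue classes and rotation\<close>

type_synonym lattice_triple = "((int \<times> int) \<times> (int \<times> int)) \<times> (int \<times> int)"

definition triple_class :: "lattice_triple \<Rightarrow> int" where
  "triple_class = (\<lambda>(((m1, n1), (m2, n2)), (m3, n3)). m1 + n1 + m2 + n2 + m3 + n3)"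

definition triple_term :: "complex \<Rightarrow> complex \<Rightarrow> complex \<Rightarrow> lattice_triple \<Rightarrow> complex" where
  "triple_term x y \<tau> = (\<lambda>((u, v), t). lattice_term x y \<tau> u * lattice_term x y \<tau> v * lattice_term x y \<tau> t)"

text \<open>Expanding the cube confines the weight \<open>w\<close> to the factor
  \<open>w powi triple_class p\<close>, so cubes with different weights can be subtracted term by
  term.\<close>

lemma triple_sum:
  assumes "Im \<tau> > 0" and "norm w = 1"
  shows "(\<lambda>p. w powi triple_class p * triple_term x y \<tau> p) summable_on UNIV"
    and "(\<Sum>\<^sub>\<infinity>p\<in>UNIV. w powi triple_class p * triple_term x y \<tau> p) = dagger w x y \<tau> ^ 3"
proof -
  define f where "f = (\<lambda>(m, n). w powi (m + n) * lattice_term x y \<tau> (m, n))"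
  have w: "w \<noteq> 0"
    using assms by auto
  have f: "f summable_on UNIV" and D: "infsum f UNIV = dagger w x y \<tau>"
    using weighted_lattice_term_summable[OF assms] by (simp_all add: f_def dagger_def)
  have eq: "(\<lambda>(p, t). (case p of (u, v) \<Rightarrow> f u * f v) * f t)
      = (\<lambda>p. w powi triple_class p * triple_term x y \<tau> p)"
    by (auto simp: fun_eq_iff f_def triple_class_def triple_term_def power_int_add w)
  have ff: "(\<lambda>(u, v). f u * f v) summable_on UNIV"
    using summable_on_product_complex[OF f f] by simp
  show "(\<lambda>p. w powi triple_class p * triple_term x y \<tau> p) summable_on UNIV"
    using summable_on_product_complex[OF ff f] by (simp add: eq)
  show "(\<Sum>\<^sub>\<infinity>p\<in>UNIV. w powi triple_class p * triple_term x y \<tau> p) = dagger w x y \<tau> ^ 3"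
    using infsum_product_complex[OF ff f] infsum_product_complex[OF f f]
    by (simp add: eq D power3_eq_cube)
qed

lemma power_int_mod_3:
  fixes w :: complex
  assumes "w ^ 3 = 1"
  shows "w powi k = w ^ nat (k mod 3)"
proof -
  have w: "w \<noteq> 0"
    using assms by auto
  have "w powi k = w powi (3 * (k div 3) + k mod 3)"
    by simp
  also have "\<dots> = (w powi 3) powi (k div 3) * w powi (k mod 3)"
    using w by (subst power_int_add) (simp_all only: power_int_mult simp_thms)
  also have "w powi 3 = 1"
    using assms by simp
  finally show ?thesis
    by (simp add: power_int_def)
qed

text \<open>
  Write \<open>V\<close> for the sum of the triple. Each vector is rotated about \<open>V / 3\<close> by the isometry
  \<open>(m, n) \<mapsto> (- n, m - n)\<close> of order three of the form \<open>m\<^sup>2 - m n + n\<^sup>2\<close>, or by its inverse,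
  according to the class of \<open>V\<close> modulo 3, and translated by the dual vector \<open>- (2/3, 1/3)\<close>.
  Exactly when that class is nonzero the result is again integral.
\<close>
definition triple_rotate :: "lattice_triple \<Rightarrow> lattice_triple" where
  "triple_rotate = (\<lambda>(((m1, n1), (m2, n2)), (m3, n3)).
     let M = m1 + m2 + m3; N = n1 + n2 + n3; k = (M + N) div 3 in
     if (M + N) mod 3 = 2 then
       (((k - n1, m1 - n1 + N - 1 - k), (k - n2, m2 - n2 + N - 1 - k)), (k - n3, m3 - n3 + N - 1 - k))
     else if (M + N) mod 3 = 1 then
       (((n1 - m1 + M - k - 1, k - m1), (n2 - m2 + M - k - 1, k - m2)), (n3 - m3 + M - k - 1, k - m3))
     else (((m1, n1), (m2, n2)), (m3, n3)))"

text \<open>Off class zero a rotated triple has its class lowered by 3, so \<open>k\<close> here is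
  one less than in \<open>triple_rotate\<close>; this accounts for the different constants.\<close>

definition triple_unrotate :: "lattice_triple \<Rightarrow> lattice_triple" where
  "triple_unrotate = (\<lambda>(((m1, n1), (m2, n2)), (m3, n3)).
     let M = m1 + m2 + m3; N = n1 + n2 + n3; k = (M + N) div 3;
       r = (\<lambda>(m, n). (n - m - N + 2 * k + 2, k + 1 - m));
       s = (\<lambda>(m, n). (k + 1 - n, m - n - M + 2 * k + 1)) in
     if (M + N) mod 3 = 2 then ((r (m1, n1), r (m2, n2)), r (m3, n3))
     else if (M + N) mod 3 = 1 then ((s (m1, n1), s (m2, n2)), s (m3, n3))
     else (((m1, n1), (m2, n2)), (m3, n3)))"

lemma int_mod_3_cases:
  obtains k where "a = 3 * k" | k where "a = 3 * k + 1" | k where "a = 3 * k + (2::int)"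
proof -
  have "a = 3 * (a div 3) + a mod 3" and "a mod 3 \<in> {0, 1, 2}"
    by auto
  then show thesis
    using that by (metis add.right_neutral empty_iff insert_iff)
qed

lemma triple_rotate_class_2:
  assumes "m1 + m2 + m3 + (n1 + n2 + n3) = 3 * k + 2"
  shows "triple_rotate (((m1, n1), (m2, n2)), (m3, n3)) =
    (let b = n1 + n2 + n3 - 1 - k in (((k - n1, m1 - n1 + b), (k - n2, m2 - n2 + b)), (k - n3, m3 - n3 + b)))"
  by (simp add: triple_rotate_def Let_def assms)

lemma triple_rotate_class_1:
  assumes "m1 + m2 + m3 + (n1 + n2 + n3) = 3 * k + 1"
  shows "triple_rotate (((m1, n1), (m2, n2)), (m3, n3)) =
    (let a = m1 + m2 + m3 - k - 1 in (((n1 - m1 + a, k - m1), (n2 - m2 + a, k - m2)), (n3 - m3 + a, k - m3)))"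
  by (simp add: triple_rotate_def Let_def assms)

lemma triple_unrotate_class_2:
  assumes "m1 + m2 + m3 + (n1 + n2 + n3) = 3 * k + 2"
  shows "triple_unrotate (((m1, n1), (m2, n2)), (m3, n3)) =
    (let a = 2 * k + 2 - (n1 + n2 + n3) in
      (((n1 - m1 + a, k + 1 - m1), (n2 - m2 + a, k + 1 - m2)), (n3 - m3 + a, k + 1 - m3)))"
  by (simp add: triple_unrotate_def Let_def assms)

lemma triple_unrotate_class_1:
  assumes "m1 + m2 + m3 + (n1 + n2 + n3) = 3 * k + 1"
  shows "triple_unrotate (((m1, n1), (m2, n2)), (m3, n3)) =
    (let b = 2 * k + 1 - (m1 + m2 + m3) in
      (((k + 1 - n1, m1 - n1 + b), (k + 1 - n2, m2 - n2 + b)), (k + 1 - n3, m3 - n3 + b)))"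
  by (simp add: triple_unrotate_def Let_def assms)

lemma triple_rotate_class_0:
  assumes "m1 + m2 + m3 + (n1 + n2 + n3) = 3 * k"
  shows "triple_rotate (((m1, n1), (m2, n2)), (m3, n3)) = (((m1, n1), (m2, n2)), (m3, n3))"
    and "triple_unrotate (((m1, n1), (m2, n2)), (m3, n3)) = (((m1, n1), (m2, n2)), (m3, n3))"
  by (simp_all add: triple_rotate_def triple_unrotate_def Let_def assms)

lemma lattice_triple_cases:
  fixes p :: lattice_triple
  obtains (0) m1 n1 m2 n2 m3 n3 k where "p = (((m1, n1), (m2, n2)), (m3, n3))"
      "m1 + m2 + m3 + (n1 + n2 + n3) = 3 * k"
  | (1) m1 n1 m2 n2 m3 n3 k where "p = (((m1, n1), (m2, n2)), (m3, n3))"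
      "m1 + m2 + m3 + (n1 + n2 + n3) = 3 * k + 1"
  | (2) m1 n1 m2 n2 m3 n3 k where "p = (((m1, n1), (m2, n2)), (m3, n3))"
      "m1 + m2 + m3 + (n1 + n2 + n3) = 3 * k + 2"
proof -
  obtain m1 n1 m2 n2 m3 n3 where "p = (((m1, n1), (m2, n2)), (m3, n3))"
    by (rule that[of "fst (fst (fst p))" "snd (fst (fst p))" "fst (snd (fst p))" "snd (snd (fst p))"
          "fst (snd p)" "snd (snd p)"]) simp
  then show thesis
    using that by (cases "m1 + m2 + m3 + (n1 + n2 + n3)" rule: int_mod_3_cases) blast+
qed

lemma triple_unrotate_rotate: "triple_unrotate (triple_rotate p) = p"
proof (cases p rule: lattice_triple_cases)
  case (0 m1 n1 m2 n2 m3 n3 k)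
  then show ?thesis by (simp add: triple_rotate_class_0)
next
  case (1 m1 n1 m2 n2 m3 n3 k)
  show ?thesis
    unfolding 1(1) triple_rotate_class_1[OF 1(2)] Let_def
    by (subst triple_unrotate_class_1[where k = "k - 1"]) (use 1(2) in \<open>simp_all add: Let_def\<close>)
next
  case (2 m1 n1 m2 n2 m3 n3 k)
  show ?thesis
    unfolding 2(1) triple_rotate_class_2[OF 2(2)] Let_def
    by (subst triple_unrotate_class_2[where k = "k - 1"]) (use 2(2) in \<open>simp_all add: Let_def\<close>)
qed

lemma triple_rotate_unrotate: "triple_rotate (triple_unrotate p) = p"
proof (cases p rule: lattice_triple_cases)
  case (0 m1 n1 m2 n2 m3 n3 k)
  then show ?thesis by (simp add: triple_rotate_class_0)
next
  case (1 m1 n1 m2 n2 m3 n3 k)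
  show ?thesis
    unfolding 1(1) triple_unrotate_class_1[OF 1(2)] Let_def
    by (subst triple_rotate_class_1[where k = "k + 1"]) (use 1(2) in \<open>simp_all add: Let_def\<close>)
next
  case (2 m1 n1 m2 n2 m3 n3 k)
  show ?thesis
    unfolding 2(1) triple_unrotate_class_2[OF 2(2)] Let_def
    by (subst triple_rotate_class_2[where k = "k + 1"]) (use 2(2) in \<open>simp_all add: Let_def\<close>)
qed

text \<open>Rotation about \<open>V / 3\<close> fixes the sum \<open>V\<close>; the three
  translations then lower it by \<open>(2, 1)\<close>, hence the class by 3.\<close>

lemma triple_class_rotate: "triple_class (triple_rotate p) mod 3 = triple_class p mod 3"
proof (cases p rule: lattice_triple_cases)
  case (0 m1 n1 m2 n2 m3 n3 k)
  then show ?thesis by (simp add: triple_rotate_class_0)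
next
  case (1 m1 n1 m2 n2 m3 n3 k)
  have "triple_class (triple_rotate p) = triple_class p - 3"
    unfolding 1(1) triple_rotate_class_1[OF 1(2)] Let_def
    using 1(2) by (simp add: triple_class_def)
  then show ?thesis by (simp only: minus_mod_self2)
next
  case (2 m1 n1 m2 n2 m3 n3 k)
  have "triple_class (triple_rotate p) = triple_class p - 3"
    unfolding 2(1) triple_rotate_class_2[OF 2(2)] Let_def
    using 2(2) by (simp add: triple_class_def)
  then show ?thesis by (simp only: minus_mod_self2)
qed

section \<open>Norms under the rotation, and differences of cubes\<close>

definition norm_form :: "int \<times> int \<Rightarrow> int" where
  "norm_form = (\<lambda>(m, n). m\<^sup>2 - m * n + n\<^sup>2)"

lemma triple_term_eq:
  "triple_term x y \<tau> ((u1, u2), u3) = exp (\<i> * (2 * of_real pi * \<tau> *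
     of_int (norm_form u1 + norm_form u2 + norm_form u3)
     + 2 * (of_int (fst u1 + fst u2 + fst u3) * x + of_int (snd u1 + snd u2 + snd u3) * y)))"
  unfolding triple_term_def lattice_term_def case_prod_unfold exp_add[symmetric]
  by (rule arg_cong[of _ _ exp]) (simp add: norm_form_def case_prod_unfold algebra_simps)

text \<open>Translating a vector by (2/3, 1/3) adds its first coordinate plus 1/3 to its norm. Over
  a triple the thirds add up to 1, which yields q^2, and the linear part is absorbed by the shift of
  \<open>x\<close>.\<close>

lemma triple_term_shift:
  assumes "norm_form u1 + norm_form u2 + norm_form u3
      = norm_form v1 + norm_form v2 + norm_form v3 + (fst v1 + fst v2 + fst v3) + 1"
    and "fst u1 + fst u2 + fst u3 = fst v1 + fst v2 + fst v3 + 2"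
    and "snd u1 + snd u2 + snd u3 = snd v1 + snd v2 + snd v3 + 1"
  shows "triple_term x y \<tau> ((u1, u2), u3) = (exp (of_real pi * \<i> * \<tau>))\<^sup>2 * exp (4 * \<i> * x + 2 * \<i> * y)
      * triple_term (x + of_real pi * \<tau>) y \<tau> ((v1, v2), v3)"
  unfolding triple_term_eq assms exp_double[symmetric] exp_add[symmetric]
  by (rule arg_cong[of _ _ exp]) (simp add: algebra_simps)

text \<open>The point \<open>V / 3\<close> is the centroid, so the total norm is three times its
  norm plus the squared distances to it; rotation about it changes neither.\<close>

lemma triple_term_rotate:
  assumes "triple_class p mod 3 \<noteq> 0"
  shows "triple_term x y \<tau> p = (exp (of_real pi * \<i> * \<tau>))\<^sup>2 * exp (4 * \<i> * x + 2 * \<i> * y)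
      * triple_term (x + of_real pi * \<tau>) y \<tau> (triple_rotate p)"
proof (cases p rule: lattice_triple_cases)
  case (0 m1 n1 m2 n2 m3 n3 k)
  then have "triple_class p = 3 * k"
    by (simp add: triple_class_def)
  then show ?thesis using assms by simp
next
  case (1 m1 n1 m2 n2 m3 n3 k)
  show ?thesis
    unfolding 1(1) triple_rotate_class_1[OF 1(2)] Let_def
    by (rule triple_term_shift; simp add: norm_form_def; use 1(2) in algebra)
next
  case (2 m1 n1 m2 n2 m3 n3 k)
  show ?thesis
    unfolding 2(1) triple_rotate_class_2[OF 2(2)] Let_def
    by (rule triple_term_shift; simp add: norm_form_def; use 2(2) in algebra)
qed

lemma dagger_cube_difference:
  assumes \<tau>: "Im \<tau> > 0" and w: "w ^ 3 = 1" and v: "v ^ 3 = 1"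
  shows "dagger w x y \<tau> ^ 3 - dagger v x y \<tau> ^ 3
    = (exp (of_real pi * \<i> * \<tau>))\<^sup>2 * exp (4 * \<i> * x + 2 * \<i> * y)
      * (dagger w (x + of_real pi * \<tau>) y \<tau> ^ 3 - dagger v (x + of_real pi * \<tau>) y \<tau> ^ 3)"
proof -
  define c where "c = (exp (of_real pi * \<i> * \<tau>))\<^sup>2 * exp (4 * \<i> * x + 2 * \<i> * y)"
  define d where "d p = w powi triple_class p - v powi triple_class p" for p
  have nw: "norm w = 1" and nv: "norm v = 1"
    using w v by (metis norm_power norm_one power_eq_1_iff norm_ge_zero zero_neq_numeral)+
  have difference: "(\<Sum>\<^sub>\<infinity>p\<in>UNIV. d p * triple_term a b \<tau> p) = dagger w a b \<tau> ^ 3 - dagger v a b \<tau> ^ 3"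
    for a b
    using infsum_add[OF triple_sum(1)[OF \<tau> nw, of a b] summable_on_uminus[THEN iffD2, OF triple_sum(1)[OF \<tau> nv, of a b]]]
    by (simp add: d_def left_diff_distrib infsum_uminus triple_sum(2)[OF \<tau> nw] triple_sum(2)[OF \<tau> nv])
  have d_rotate: "d (triple_rotate p) = d p" for p
    using triple_class_rotate[of p] by (simp add: d_def power_int_mod_3[OF w] power_int_mod_3[OF v])
  \<comment> \<open>On class zero \<open>triple_rotate\<close> is only the identity and gives no
    relation between the terms; the vanishing weight makes both sides zero.\<close>
  have d_0: "d p = 0" if "triple_class p mod 3 = 0" for p
    using that by (simp add: d_def power_int_mod_3[OF w] power_int_mod_3[OF v])
  have "(\<Sum>\<^sub>\<infinity>p\<in>UNIV. d p * triple_term x y \<tau> p)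
      = (\<Sum>\<^sub>\<infinity>p\<in>UNIV. c * (d p * triple_term (x + of_real pi * \<tau>) y \<tau> p))"
  proof (rule infsum_reindex_bij_witness[of _ triple_unrotate triple_rotate])
    fix p
    show "c * (d (triple_rotate p) * triple_term (x + of_real pi * \<tau>) y \<tau> (triple_rotate p))
        = d p * triple_term x y \<tau> p"
      by (cases "triple_class p mod 3 = 0")
        (simp_all add: d_rotate d_0 triple_term_rotate c_def)
  qed (simp_all add: triple_unrotate_rotate triple_rotate_unrotate)
  then show ?thesis
    by (simp add: infsum_cmult_right' difference c_def)
qed

section \<open>Cubic characters and the product of three \<open>theta3\<close> values\<close>

lemma omega_cube: "omega ^ 3 = 1"
  by (simp add: omega_def mult_ac flip: exp_of_nat_mult)

lemma inverse_omega: "inverse omega = omega ^ 2"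
  by (rule inverse_unique) (use omega_cube in \<open>simp add: power_numeral_reduce\<close>)

lemma omega_sum: "1 + omega + omega ^ 2 = 0"
proof -
  have "omega = cis (2 * pi / 3)"
    by (simp add: omega_def cis_conv_exp mult_ac)
  then have omega: "omega = Complex (- 1 / 2) (sqrt 3 / 2)"
    by (simp add: complex_eq_iff cos_120 sin_120)
  show ?thesis
    unfolding omega by (simp add: complex_eq_iff power2_eq_square)
qed

text \<open>Orthogonality of the characters modulo 3, used as a filter on the index sum.\<close>

lemma sum_omega_powi:
  "1 + inverse omega powi k + omega powi k = (if 3 dvd k then 3 else 0)"
proof -
  have inv3: "inverse omega ^ 3 = 1"
    by (simp add: power_inverse omega_cube)
  have "(omega ^ 2) ^ 2 = omega"
    using omega_cube by (simp add: power_numeral_reduce)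
  moreover have "k mod 3 \<in> {0, 1, 2}"
    by auto
  ultimately show ?thesis
    using omega_sum
    by (elim insertE emptyE) (simp_all add: power_int_mod_3[OF omega_cube]
        power_int_mod_3[OF inv3[unfolded inverse_omega]] dvd_eq_mod_eq_0 inverse_omega add_ac)
qed

text \<open>The series has period \<pi>, so translation by a third of it acts on the terms by a
  cubic character.\<close>

lemma theta_term_shift:
  "theta_term (z + of_real pi / 3) \<tau> n = omega powi n * theta_term z \<tau> n"
  "theta_term (z - of_real pi / 3) \<tau> n = inverse omega powi n * theta_term z \<tau> n"
proof -
  have "omega powi k = exp (of_int k * (2 * of_real pi * \<i> / 3))" for k
    by (simp add: omega_def exp_power_int)
  then show "theta_term (z + of_real pi / 3) \<tau> n = omega powi n * theta_term z \<tau> n"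
    and "theta_term (z - of_real pi / 3) \<tau> n = inverse omega powi n * theta_term z \<tau> n"
    by (simp_all add: theta_term_def algebra_simps power_int_inverse flip: exp_add exp_minus)
qed

lemma weighted_dagger_theta_product:
  fixes w x y z \<tau> :: complex
  assumes \<tau>: "Im \<tau> > 0" and w: "norm w = 1"
  defines "f \<equiv> \<lambda>((m, n), p). w powi (m + n + p) * (lattice_term x y \<tau> (m, n) * theta_term z \<tau> p)"
  shows "f summable_on UNIV"
    and "infsum f UNIV = dagger w x y \<tau> * (\<Sum>\<^sub>\<infinity>p\<in>UNIV. w powi p * theta_term z \<tau> p)"
proof -
  have w0: "w \<noteq> 0"
    using w by auto
  have "(\<lambda>p. norm (theta_term z \<tau> p)) summable_on UNIV"
    using theta_term_summable[OF \<tau>] by (simp only: summable_on_iff_abs_summable_on_complex)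
  then have "(\<lambda>p. norm (w powi p * theta_term z \<tau> p)) summable_on UNIV"
    by (simp add: norm_mult norm_power_int w)
  then have t: "(\<lambda>p. w powi p * theta_term z \<tau> p) summable_on UNIV"
    by (rule abs_summable_summable)
  have eq: "(\<lambda>(u, p). (case u of (m, n) \<Rightarrow> w powi (m + n) * lattice_term x y \<tau> (m, n)) *
      (w powi p * theta_term z \<tau> p)) = f"
    by (auto simp: fun_eq_iff f_def power_int_add w0)
  note l = weighted_lattice_term_summable[OF \<tau> w, of x y]
  show "f summable_on UNIV"
    using summable_on_product_complex[OF l t] by (simp add: eq)
  show "infsum f UNIV = dagger w x y \<tau> * (\<Sum>\<^sub>\<infinity>p\<in>UNIV. w powi p * theta_term z \<tau> p)"
    using infsum_product_complex[OF l t] by (simp add: eq dagger_def)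
qed

text \<open>
  Summing over the three cube roots of unity \<open>w\<close> selects the terms with \<open>3 dvd m + n + p\<close>. These
  are \<open>p = a + b + c\<close>, \<open>m = c - a\<close>, \<open>n = c - b\<close>, for which
  \<open>p\<^sup>2 + 2 (m\<^sup>2 - m n + n\<^sup>2) = 3 (a\<^sup>2 + b\<^sup>2 + c\<^sup>2)\<close>.
\<close>
lemma theta3_product:
  assumes \<tau>: "Im \<tau> > 0"
  shows "3 * theta3 (z + x) \<tau> * theta3 (z + y) \<tau> * theta3 (z - x - y) \<tau>
    = A_dagger (- x) (- y) (\<tau> / 3) * theta3 z (\<tau> / 3)
      + C_dagger x y (\<tau> / 3) * theta3 (z - of_real pi / 3) (\<tau> / 3)
      + C_dagger (- x) (- y) (\<tau> / 3) * theta3 (z + of_real pi / 3) (\<tau> / 3)"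
proof -
  define s where "s = \<tau> / 3"
  have s: "Im s > 0"
    using \<tau> by (simp add: s_def)
  define G where "G = (\<lambda>((m, n), p). lattice_term (- x) (- y) s (m, n) * theta_term z s p)"
  define f where "f w = (\<lambda>((m, n), p). w powi (m + n + p) *
    (lattice_term (- x) (- y) s (m, n) * theta_term z s p))" for w :: complex
  define H where "H = (\<lambda>((a, b), c).
    theta_term (z + x) \<tau> a * theta_term (z + y) \<tau> b * theta_term (z - x - y) \<tau> c)"
  have norm_omega: "norm omega = 1"
    by (simp add: omega_def norm_exp_eq_Re)
  then have norm_inv: "norm (inverse omega) = 1"
    by (simp add: norm_inverse)
  have norm_1: "norm (1 :: complex) = 1"
    by simp
  note sums = weighted_dagger_theta_product[OF s _, where x = "- x" and y = "- y" and z = z, folded f_def]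
  have rhs: "A_dagger (- x) (- y) s * theta3 z s
      + C_dagger x y s * theta3 (z - of_real pi / 3) s
      + C_dagger (- x) (- y) s * theta3 (z + of_real pi / 3) s
      = infsum (f 1) UNIV + infsum (f (inverse omega)) UNIV + infsum (f omega) UNIV"
    \<comment> \<open>Relative to the arguments \<open>- x\<close>, \<open>- y\<close>, the series
      \<open>C_dagger x y\<close> has weight \<open>inverse omega\<close>, as does the translate by
      - \<pi> / 3; thus each product carries a single character of \<open>m + n + p\<close>.\<close>
    using dagger_minus[of "inverse omega" x y s]
    by (simp add: sums(2) norm_1 norm_omega norm_inv theta3_eq theta_term_shift A_dagger_eq C_dagger_eq)
  also have "\<dots> = (\<Sum>\<^sub>\<infinity>t\<in>UNIV. f 1 t + f (inverse omega) t + f omega t)"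
    by (simp add: infsum_add summable_on_add sums(1) norm_1 norm_omega norm_inv)
  also have "\<dots> = (\<Sum>\<^sub>\<infinity>t\<in>{((m, n), p). 3 dvd m + n + p}. 3 * G t)"
  proof (rule infsum_cong_neutral)
    have *: "f 1 ((m, n), p) + f (inverse omega) ((m, n), p) + f omega ((m, n), p)
        = (if 3 dvd m + n + p then 3 * G ((m, n), p) else 0)" for m n p
    proof -
      have "f 1 ((m, n), p) + f (inverse omega) ((m, n), p) + f omega ((m, n), p)
          = (1 + inverse omega powi (m + n + p) + omega powi (m + n + p)) * G ((m, n), p)"
        by (simp add: f_def G_def distrib_right)
      then show ?thesis
        by (simp only: sum_omega_powi) simp
    qed
    show "f 1 t + f (inverse omega) t + f omega t = 0" if "t \<in> UNIV - {((m, n), p). 3 dvd m + n + p}" for t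
      using that by (auto simp: * split: if_splits)
    show "f 1 t + f (inverse omega) t + f omega t = 3 * G t" if "t \<in> UNIV \<inter> {((m, n), p). 3 dvd m + n + p}" for t
      using that by (auto simp: * split: if_splits)
  qed simp
  also have "\<dots> = (\<Sum>\<^sub>\<infinity>t\<in>UNIV. 3 * H t)"
  \<comment> \<open>From \<open>p = a + b + c = 3 * c - m - n\<close> one recovers \<open>c\<close>;
    the division is exact on the selected terms.\<close>
  proof (rule infsum_reindex_bij_witness[of _ "\<lambda>((a, b), c). ((c - a, c - b), a + b + c)"
        "\<lambda>((m, n), p). (((m + n + p) div 3 - m, (m + n + p) div 3 - n), (m + n + p) div 3)"])
    fix t :: "(int \<times> int) \<times> int"
    assume "t \<in> {((m, n), p). 3 dvd m + n + p}"
    then obtain m n p k where t: "t = ((m, n), p)" and k: "m + n + p = 3 * k"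
      by auto
    have p: "p = 3 * k - m - n"
      using k by simp
    \<comment> \<open>The linear parts agree because a x + b y - c (x + y) = - (m x + n y), which
      explains the negated arguments.\<close>
    have G: "theta_term (z + x) \<tau> a * theta_term (z + y) \<tau> b * theta_term (z - x - y) \<tau> c
        = G ((c - a, c - b), a + b + c)" for a b c
      unfolding G_def theta_term_def lattice_term_def prod.case exp_add[symmetric]
      by (rule arg_cong[of _ _ exp]) (simp add: s_def power2_eq_square field_simps)
    show "3 * H ((\<lambda>((m, n), p). (((m + n + p) div 3 - m, (m + n + p) div 3 - n), (m + n + p) div 3)) t) = 3 * G t"
      by (simp only: t k H_def G prod.case) (simp add: p algebra_simps)
  qed auto
  also have "\<dots> = 3 * (theta3 (z + x) \<tau> * theta3 (z + y) \<tau> * theta3 (z - x - y) \<tau>)"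
  proof -
    note t = theta_term_summable[OF \<tau>]
    have tt: "(\<lambda>(a, b). theta_term (z + x) \<tau> a * theta_term (z + y) \<tau> b) summable_on UNIV"
      using summable_on_product_complex[OF t t] by simp
    show ?thesis
      using infsum_product_complex[OF tt t, of "z - x - y"] infsum_product_complex[OF t t, of "z + x" "z + y"]
      by (simp add: theta3_eq H_def case_prod_unfold infsum_cmult_right')
  qed
  finally show ?thesis
    by (simp add: s_def)
qed

section \<open>From \<open>theta3\<close> to \<open>theta1\<close> by half-period
  translation\<close>

text \<open>As (2 n + 1)^2 / 4 = n^2 + n + 1/4, the sign and the linear term shift the argument, and
  the constant joins the prefactor.\<close>

lemma theta1_eq_theta3:
  "theta1 z \<tau> = - \<i> * exp (\<i> * (z + of_real pi * \<tau> / 4)) * theta3 (z + of_real pi / 2 + of_real pi * \<tau> / 2) \<tau>"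
proof -
  define u where "u = z + of_real pi / 2 + of_real pi * \<tau> / 2"
  define c where "c = exp (\<i> * (z + of_real pi * \<tau> / 4))"
  have "(- 1) powi n * nome_power \<tau> (of_int ((2 * n + 1)\<^sup>2) / 4) * exp (of_int (2 * n + 1) * \<i> * z)
      = c * theta_term u \<tau> n" for n
  proof -
    have "(- 1 :: complex) = exp (of_real pi * \<i>)"
      by simp
    then have sign: "(- 1 :: complex) powi n = exp (of_int n * (of_real pi * \<i>))"
      by (simp only: exp_power_int)
    show ?thesis
      unfolding sign nome_power_def theta_term_def u_def c_def exp_add[symmetric]
      by (rule arg_cong[of _ _ exp]) (simp add: field_simps power2_eq_square)
  qed
  then show ?thesis
    by (simp add: theta1_def theta3_eq infsum_cmult_right' flip: u_def c_def)
qed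

text \<open>The translation turns n^2 into n^2 + 2 n = (n + 1)^2 - 1, so reindexing by one restores
  the series.\<close>

lemma theta3_quasi_period:
  "theta3 (z + of_real pi * \<tau>) \<tau> = exp (- \<i> * (of_real pi * \<tau> + 2 * z)) * theta3 z \<tau>"
  unfolding theta3_eq infsum_cmult_right'[symmetric]
  by (rule infsum_reindex_bij_witness[of _ "\<lambda>n. n - 1" "\<lambda>n. n + 1"])
    (auto simp: theta_term_def power2_eq_square algebra_simps simp flip: exp_add)

text \<open>The half-period for \<open>\<tau> / 3\<close> differs from that for
  \<open>\<tau>\<close> by one quasi-period, since 1/2 - 1/6 = 1/3. This allows one common
  translation on both sides of the product identity.\<close>

lemma theta1_third_eq_theta3:
  "theta1 z (\<tau> / 3) = \<i> * exp (\<i> * (3 * z + 3 * of_real pi * \<tau> / 4))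
     * theta3 (z + of_real pi / 2 + of_real pi * \<tau> / 2) (\<tau> / 3)"
proof -
  define u where "u = z + of_real pi / 2 + of_real pi * \<tau> / 6"
  have u: "z + of_real pi / 2 + of_real pi * (\<tau> / 3) / 2 = u"
    and "z + of_real pi / 2 + of_real pi * \<tau> / 2 = u + of_real pi * (\<tau> / 3)"
    by (simp_all add: u_def field_simps)
  then have t: "theta3 (z + of_real pi / 2 + of_real pi * \<tau> / 2) (\<tau> / 3)
      = exp (- \<i> * (of_real pi * (\<tau> / 3) + 2 * u)) * theta3 u (\<tau> / 3)"
    by (simp only: theta3_quasi_period)
  \<comment> \<open>The summand \<pi> in \<open>2 * u\<close> contributes the factor -1 that changes
    the prefactor \<open>- \<i>\<close> into \<open>\<i>\<close>.\<close>
  have "exp (\<i> * (3 * z + 3 * of_real pi * \<tau> / 4)) * exp (- \<i> * (of_real pi * (\<tau> / 3) + 2 * u))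
      = exp (\<i> * (z + of_real pi * (\<tau> / 3) / 4) + - (of_real pi * \<i>))"
    unfolding exp_add[symmetric]
    by (rule arg_cong[of _ _ exp]) (simp add: u_def field_simps)
  also have "\<dots> = - exp (\<i> * (z + of_real pi * (\<tau> / 3) / 4))"
    unfolding exp_add exp_minus by simp
  finally have "exp (\<i> * (z + of_real pi * (\<tau> / 3) / 4)) =
      - (exp (\<i> * (3 * z + 3 * of_real pi * \<tau> / 4)) * exp (- \<i> * (of_real pi * (\<tau> / 3) + 2 * u)))"
    by simp
  then show ?thesis
    unfolding t theta1_eq_theta3 u by (simp only:) simp
qed

text \<open>This is \<open>theta3_product\<close> at \<open>z + h\<close> times
  \<open>\<i> * E\<close>. As \<open>E\<close> involves \<open>3 * z\<close>, translating
  \<open>z\<close> by a third of \<pi> in either direction reverses its sign, whence the minus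
  signs.\<close>

lemma theta1_product:
  assumes \<tau>: "Im \<tau> > 0"
  shows "3 * theta1 (z + x) \<tau> * theta1 (z + y) \<tau> * theta1 (z - x - y) \<tau>
    = A_dagger (- x) (- y) (\<tau> / 3) * theta1 z (\<tau> / 3)
      - C_dagger x y (\<tau> / 3) * theta1 (z - of_real pi / 3) (\<tau> / 3)
      - C_dagger (- x) (- y) (\<tau> / 3) * theta1 (z + of_real pi / 3) (\<tau> / 3)"
proof -
  define h where "h = complex_of_real pi / 2 + of_real pi * \<tau> / 2"
  define E where "E = exp (\<i> * (3 * z + 3 * of_real pi * \<tau> / 4))"
  have theta1: "theta1 (z + a) \<tau> = - \<i> * exp (\<i> * (z + a + of_real pi * \<tau> / 4)) * theta3 (z + h + a) \<tau>" for a
    by (simp add: theta1_eq_theta3 h_def add_ac)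
  \<comment> \<open>The three translations \<open>x\<close>, \<open>y\<close>,
    \<open>- x - y\<close> add up to zero and drop out of the product.\<close>
  have E: "exp (\<i> * (z + x + of_real pi * \<tau> / 4)) * exp (\<i> * (z + y + of_real pi * \<tau> / 4))
      * exp (\<i> * (z + (- x - y) + of_real pi * \<tau> / 4)) = E"
    unfolding E_def exp_add[symmetric]
    by (rule arg_cong[of _ _ exp]) (simp add: field_simps)
  have lhs: "3 * theta1 (z + x) \<tau> * theta1 (z + y) \<tau> * theta1 (z + (- x - y)) \<tau>
      = \<i> * E * (3 * theta3 (z + h + x) \<tau> * theta3 (z + h + y) \<tau> * theta3 (z + h - x - y) \<tau>)"
    unfolding theta1 E[symmetric] by (simp add: algebra_simps)
  have t0: "theta1 z (\<tau> / 3) = \<i> * E * theta3 (z + h) (\<tau> / 3)"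
    by (simp add: theta1_third_eq_theta3 E_def h_def add_ac)
  have tp: "theta1 (z + of_real pi / 3) (\<tau> / 3) = - (\<i> * E * theta3 (z + h + of_real pi / 3) (\<tau> / 3))"
  proof -
    have "exp (\<i> * (3 * (z + of_real pi / 3) + 3 * of_real pi * \<tau> / 4))
        = exp (\<i> * (3 * z + 3 * of_real pi * \<tau> / 4) + of_real pi * \<i>)"
      by (rule arg_cong[of _ _ exp]) (simp add: field_simps)
    also have "\<dots> = - E"
      unfolding exp_add E_def by simp
    finally show ?thesis
      by (simp add: theta1_third_eq_theta3 h_def add_ac)
  qed
  have tm: "theta1 (z - of_real pi / 3) (\<tau> / 3) = - (\<i> * E * theta3 (z + h - of_real pi / 3) (\<tau> / 3))"
  proof -
    have "exp (\<i> * (3 * (z - of_real pi / 3) + 3 * of_real pi * \<tau> / 4))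
        = exp (\<i> * (3 * z + 3 * of_real pi * \<tau> / 4) + - (of_real pi * \<i>))"
      by (rule arg_cong[of _ _ exp]) (simp add: field_simps)
    also have "\<dots> = - E"
      unfolding exp_add E_def exp_minus by simp
    finally show ?thesis
      by (simp add: theta1_third_eq_theta3 h_def algebra_simps)
  qed
  show ?thesis
    using lhs unfolding t0 tp tm theta3_product[OF \<tau>] by (simp add: algebra_simps)
qed

theorem theorem3p2:
  fixes \<tau> q :: complex
  assumes "Im \<tau> > 0" and "q = exp (of_real pi * \<i> * \<tau>)"
  shows "\<forall>x y z :: complex.
      3 * theta1 (z + x) \<tau> * theta1 (z + y) \<tau> * theta1 (z - x - y) \<tau>
        = A_dagger (- x) (- y) (\<tau> / 3) * theta1 z (\<tau> / 3)
          - C_dagger x y (\<tau> / 3) * theta1 (z - of_real pi / 3) (\<tau> / 3)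
          - C_dagger (- x) (- y) (\<tau> / 3) * theta1 (z + of_real pi / 3) (\<tau> / 3)
    \<and> 3 * theta3 (z + x) \<tau> * theta3 (z + y) \<tau> * theta3 (z - x - y) \<tau>
        = A_dagger (- x) (- y) (\<tau> / 3) * theta3 z (\<tau> / 3)
          + C_dagger x y (\<tau> / 3) * theta3 (z - of_real pi / 3) (\<tau> / 3)
          + C_dagger (- x) (- y) (\<tau> / 3) * theta3 (z + of_real pi / 3) (\<tau> / 3)
    \<and> C_dagger x y \<tau> ^ 3 - C_dagger (- x) (- y) \<tau> ^ 3
        = q\<^sup>2 * exp (4 * \<i> * x + 2 * \<i> * y) * C_dagger (x + of_real pi * \<tau>) y \<tau> ^ 3
          - q\<^sup>2 * exp (4 * \<i> * x + 2 * \<i> * y) * C_dagger (- x - of_real pi * \<tau>) (- y) \<tau> ^ 3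
    \<and> A_dagger x y \<tau> ^ 3 - C_dagger x y \<tau> ^ 3
        = q\<^sup>2 * exp (4 * \<i> * x + 2 * \<i> * y) * A_dagger (x + of_real pi * \<tau>) y \<tau> ^ 3
          - q\<^sup>2 * exp (4 * \<i> * x + 2 * \<i> * y) * C_dagger (x + of_real pi * \<tau>) y \<tau> ^ 3"
proof (intro allI conjI)
  fix x y z :: complex
  have inv: "inverse omega ^ 3 = 1"
    by (simp add: power_inverse omega_cube)
  \<comment> \<open>The third identity thus compares the weights \<open>omega\<close> and
    \<open>inverse omega\<close>, the fourth \<open>1\<close> and \<open>omega\<close>.\<close>
  have minus: "C_dagger (- a) (- b) \<tau> = dagger (inverse omega) a b \<tau>" for a b
    by (simp add: C_dagger_eq dagger_minus)
  show "C_dagger x y \<tau> ^ 3 - C_dagger (- x) (- y) \<tau> ^ 3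
      = q\<^sup>2 * exp (4 * \<i> * x + 2 * \<i> * y) * C_dagger (x + of_real pi * \<tau>) y \<tau> ^ 3
        - q\<^sup>2 * exp (4 * \<i> * x + 2 * \<i> * y) * C_dagger (- x - of_real pi * \<tau>) (- y) \<tau> ^ 3"
    using dagger_cube_difference[OF assms(1) omega_cube inv, of x y] minus[of x y] minus[of "x + of_real pi * \<tau>" y]
    by (simp add: assms(2) C_dagger_eq right_diff_distrib)
  show "A_dagger x y \<tau> ^ 3 - C_dagger x y \<tau> ^ 3
      = q\<^sup>2 * exp (4 * \<i> * x + 2 * \<i> * y) * A_dagger (x + of_real pi * \<tau>) y \<tau> ^ 3
        - q\<^sup>2 * exp (4 * \<i> * x + 2 * \<i> * y) * C_dagger (x + of_real pi * \<tau>) y \<tau> ^ 3"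
    using dagger_cube_difference[OF assms(1) _ omega_cube, of 1 x y]
    by (simp add: assms(2) A_dagger_eq C_dagger_eq right_diff_distrib)
qed (rule theta1_product[OF assms(1)] theta3_product[OF assms(1)])+

end
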